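(* Consider a sequence of experiments indexed by the number of units $n$, each with an undirected network in which every unit has degree at least $2$, and consider testing the no-interference model $\mathcal{M}_0$ against the network linear-in-means model $\mathcal{M}_1$. Fix $p\in(0,1)$. If the maximum degree satisfies $d_{\max}=o(n^{1/5})$, then the Bernoulli design $\mathcal{D}$ (with treatment probability $p$) together with the threshold test $\phi=\mathbf{1}[\widehat g\ge\tau]$ with $\tau=(d_{\max}^5/n)^{1/4}$ are uniformly consistent: $\lim_{n\to\infty}\mathcal{R}(\mathcal{D},\phi,\delta)=0$ for all fixed $\delta>0$.
   Context: **Setting.** There are $n$ units, interventions are $\boldsymbol{z}\in\{0,1\}^n$, and a potential outcome function is $\boldsymbol{y}=(y_1,\dots,y_n):\{0,1\}^n\to\mathbb{R}^n$ with $\|\boldsymbol{y}\|_\infty=\max_i\max_{\boldsymbol{z}}|y_i(\boldsymbol{z})|$. The units are nodes of an observed undirected network (without self-loops); $\mathcal{N}(i)$ is the set of neighbors of $i$, $d_i=|\mathcal{N}(i)|\ge 2$ for all $i$, and $d_{\max}=\max_i d_i$. Let $T_i(\boldsymbol{z})=|\mathcal{N}(i)|^{-1}\sum_{j\in\mathcal{N}(i)}z_j$. All objects (network, models) may depend on $n$. **Models.** The null is $$\mathcal{M}_0=\{\boldsymbol{y}: y_i(\boldsymbol{z})=\alpha_{i,1}\mathbf{1}[z_i=1]+\alpha_{i,0}\mathbf{1}[z_i=0]\ \text{for all } i,\ \|\boldsymbol{y}\|_\infty\le1\},$$ and the alternative (linear-in-means) is $$\mathcal{M}_1=\{\boldsymbol{y}: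 y_i(\boldsymbol{z})=\beta_{i,1}+\beta_{i,2}z_i+\beta_{i,3}T_i(\boldsymbol{z})\ \text{for all } i,\ \|\boldsymbol{y}\|_\infty\le1\},$$ with real coefficients. The separation functional on $\mathcal{M}_1$ is $g(\boldsymbol{y})=n^{-1}\sum_{i=1}^n\beta_{i,3}^2$, and $\mathcal{M}_1(\delta)=\{\boldsymbol{y}\in\mathcal{M}_1:g(\boldsymbol{y})\ge\delta\}$. **Design and estimator.** Under the Bernoulli design $\mathcal{D}$, $z_1,\dots,z_n$ are independent with $\Pr(z_i=1)=p$, where $p\in(0,1)$ is fixed (not depending on $n$). Write $T_i=T_i(\boldsymbol{z})$ and $Y_i=y_i(\boldsymbol{z})$ (observed outcome). The estimator is $\widehat g=n^{-1}\sum_{i=1}^nW_iY_i^2$ with $$W_i=\frac{\mathrm{Var}(T_i)\left(T_i^2-\mathrm{E}[T_i^2]\right)-\left(\mathrm{E}[T_i^3]-\mathrm{E}[T_i^2]\mathrm{E}[T_i]\right)\left(T_i-\mathrm{E}[T_i]\right)}{\mathrm{Var}(T_i)\left(\mathrm{E}[T_i^4]-\mathrm{E}[T_i^2]^2\right)-\left(\mathrm{E}[T_i^3]-\mathrm{E}[T_i^2]\mathrm{E}[T_i]\right)^2},$$ all moments being under $\mathcal{D}$. **Testing error.** For a test $\phi(\boldsymbol{z},\boldsymbol{y}(\boldsymbol{z}))\in\{0,1\}$, $$\mathcal{R}(\mathcal{D},\phi,\delta)=\sup_{\boldsymbol{y}\in\mathcal{M}_0}\mathrm{E}_{\boldsymbol{z}\sim\mathcal{D}}[\phi(\boldsymbol{z},\boldsymbol{y}(\boldsymbol{z}))]+\sup_{\boldsymbol{y}\in\mathcal{M}_1(\delta)}\mathrm{E}_{\boldsymbol{z}\sim\mathcal{D}}[1-\phi(\boldsymbol{z},\boldsymbol{y}(\boldsymbol{z}))],$$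 where the supremum over an empty set is read as $0$. *)

theory Defs
  imports "HOL-Probability.Probability" "HOL-Library.Landau_Symbols"
begin

text \<open>
  The units are the numbers below \<open>n\<close>. An intervention in \<open>{0,1}^n\<close> is a map \<open>nat \<Rightarrow> bool\<close> that is
  \<open>False\<close> outside \<open>{..<n}\<close>, which is also the default value used by the product pmf below.
\<close>

definition interventions :: "nat \<Rightarrow> (nat \<Rightarrow> bool) set" where
  "interventions n = PiE_dflt {..<n} False (\<lambda>_. UNIV)"

text \<open>Potential outcomes are written \<open>y z i\<close>, so that \<open>y z\<close> is the observed outcome vector.\<close>

type_synonym outcome_fun = "(nat \<Rightarrow> bool) \<Rightarrow> nat \<Rightarrow> real"

definition outcome_funs :: "nat \<Rightarrow> outcome_fun set" where
  "outcome_funs n = interventions n \<rightarrow>\<^sub>E ({..<n} \<rightarrow>\<^sub>E UNIV)"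

definition outcome_norm :: "nat \<Rightarrow> outcome_fun \<Rightarrow> real" where
  "outcome_norm n y = Max ((\<lambda>(i, z). \<bar>y z i\<bar>) ` ({..<n} \<times> interventions n))"

text \<open>An undirected network without self-loops is a symmetric, irreflexive edge relation.\<close>

definition network :: "nat \<Rightarrow> (nat \<times> nat) set \<Rightarrow> bool" where
  "network n E \<longleftrightarrow> E \<subseteq> {..<n} \<times> {..<n} \<and> sym E \<and> irrefl E"

definition neighbors :: "(nat \<times> nat) set \<Rightarrow> nat \<Rightarrow> nat set" where
  "neighbors E i = E `` {i}"

definition deg :: "(nat \<times> nat) set \<Rightarrow> nat \<Rightarrow> nat" where
  "deg E i = card (neighbors E i)"

definition max_deg :: "nat \<Rightarrow> (nat \<times> nat) set \<Rightarrow> nat" where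
  "max_deg n E = Max (deg E ` {..<n})"

definition exposure :: "(nat \<times> nat) set \<Rightarrow> nat \<Rightarrow> (nat \<Rightarrow> bool) \<Rightarrow> real" where
  "exposure E i z = (\<Sum>j\<in>neighbors E i. of_bool (z j)) / real (deg E i)"

definition null_model :: "nat \<Rightarrow> outcome_fun set" where
  "null_model n = {y \<in> outcome_funs n.
     (\<exists>\<alpha>1 \<alpha>0. \<forall>i<n. \<forall>z\<in>interventions n.
        y z i = \<alpha>1 i * of_bool (z i) + \<alpha>0 i * of_bool (\<not> z i)) \<and>
     outcome_norm n y \<le> 1}"

definition linear_in_means_model :: "nat \<Rightarrow> (nat \<times> nat) set \<Rightarrow> outcome_fun set" where
  "linear_in_means_model n E = {y \<in> outcome_funs n.
     (\<exists>\<beta>1 \<beta>2 \<beta>3. \<forall>i<n. \<forall>z\<in>interventions n.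
        y z i = \<beta>1 i + \<beta>2 i * of_bool (z i) + \<beta>3 i * exposure E i z) \<and>
     outcome_norm n y \<le> 1}"

text \<open>
  The coefficient \<open>\<beta>3 i\<close> as a function of \<open>y\<close>. It is uniquely determined as soon as unit \<open>i\<close> has
  a neighbor; see \<open>interference_coeff_eq\<close> below.
\<close>

definition interference_coeff :: "nat \<Rightarrow> (nat \<times> nat) set \<Rightarrow> outcome_fun \<Rightarrow> nat \<Rightarrow> real" where
  "interference_coeff n E y i = (THE b. \<exists>a c. \<forall>z\<in>interventions n.
     y z i = a + c * of_bool (z i) + b * exposure E i z)"

definition separation :: "nat \<Rightarrow> (nat \<times> nat) set \<Rightarrow> outcome_fun \<Rightarrow> real" where
  "separation n E y = (\<Sum>i<n. (interference_coeff n E y i)\<^sup>2) / real n"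

definition separated_model :: "nat \<Rightarrow> (nat \<times> nat) set \<Rightarrow> real \<Rightarrow> outcome_fun set" where
  "separated_model n E \<delta> = {y \<in> linear_in_means_model n E. separation n E y \<ge> \<delta>}"

definition bernoulli_design :: "nat \<Rightarrow> real \<Rightarrow> (nat \<Rightarrow> bool) pmf" where
  "bernoulli_design n p = Pi_pmf {..<n} False (\<lambda>_. bernoulli_pmf p)"

definition weight :: "(nat \<Rightarrow> bool) pmf \<Rightarrow> (nat \<times> nat) set \<Rightarrow> nat \<Rightarrow> (nat \<Rightarrow> bool) \<Rightarrow> real" where
  "weight D E i z =
     (let m = (\<lambda>k::nat. measure_pmf.expectation D (\<lambda>z. exposure E i z ^ k));
          V = measure_pmf.variance D (exposure E i)
      in (V * ((exposure E i z)\<^sup>2 - m 2) - (m 3 - m 2 * m 1) * (exposure E i z - m 1)) /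
         (V * (m 4 - (m 2)\<^sup>2) - (m 3 - m 2 * m 1)\<^sup>2))"

definition g_hat ::
  "nat \<Rightarrow> (nat \<Rightarrow> bool) pmf \<Rightarrow> (nat \<times> nat) set \<Rightarrow> (nat \<Rightarrow> bool) \<Rightarrow> (nat \<Rightarrow> real) \<Rightarrow> real" where
  "g_hat n D E z Y = (\<Sum>i<n. weight D E i z * (Y i)\<^sup>2) / real n"

definition threshold :: "nat \<Rightarrow> (nat \<times> nat) set \<Rightarrow> real" where
  "threshold n E = (real (max_deg n E) ^ 5 / real n) powr (1 / 4)"

definition threshold_test ::
  "nat \<Rightarrow> (nat \<Rightarrow> bool) pmf \<Rightarrow> (nat \<times> nat) set \<Rightarrow> (nat \<Rightarrow> bool) \<Rightarrow> (nat \<Rightarrow> real) \<Rightarrow> bool" where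
  "threshold_test n D E z Y \<longleftrightarrow> g_hat n D E z Y \<ge> threshold n E"

text \<open>
  On \<open>real\<close>, \<open>Sup {}\<close> is unspecified; the supremum over an empty model is read as 0. The suprema
  below are of expectations in \<open>[0, 1]\<close>, hence of bounded sets.
\<close>

definition sup0 :: "('a \<Rightarrow> real) \<Rightarrow> 'a set \<Rightarrow> real" where
  "sup0 f A = (if A = {} then 0 else SUP x\<in>A. f x)"

definition testing_error ::
  "nat \<Rightarrow> (nat \<times> nat) set \<Rightarrow> (nat \<Rightarrow> bool) pmf \<Rightarrow>
   ((nat \<Rightarrow> bool) \<Rightarrow> (nat \<Rightarrow> real) \<Rightarrow> bool) \<Rightarrow> real \<Rightarrow> real" where
  "testing_error n E D \<phi> \<delta> =
     sup0 (\<lambda>y. measure_pmf.expectation D (\<lambda>z. of_bool (\<phi> z (y z)))) (null_model n) +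
     sup0 (\<lambda>y. measure_pmf.expectation D (\<lambda>z. 1 - of_bool (\<phi> z (y z)))) (separated_model n E \<delta>)"

lemma interference_coeff_eq:
  assumes net: "network n E" and i: "i < n" and ne: "neighbors E i \<noteq> {}"
    and y: "\<And>z. z \<in> interventions n \<Longrightarrow> y z i = a + c * of_bool (z i) + b * exposure E i z"
  shows "interference_coeff n E y i = b"
  unfolding interference_coeff_def
proof (rule the_equality)
  show "\<exists>a c. \<forall>z\<in>interventions n. y z i = a + c * of_bool (z i) + b * exposure E i z"
    using y by blast
next
  fix b' assume "\<exists>a c. \<forall>z\<in>interventions n. y z i = a + c * of_bool (z i) + b' * exposure E i z"
  then obtain a' c' where
    y': "\<And>z. z \<in> interventions n \<Longrightarrow> y z i = a' + c' * of_bool (z i) + b' * exposure E i z" by blast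
  obtain j where j: "j \<in> neighbors E i" using ne by blast
  have sub: "neighbors E i \<subseteq> {..<n}" and ij: "i \<noteq> j" and jn: "j < n"
    using net j by (auto simp: network_def neighbors_def irrefl_def)
  have fin: "finite (neighbors E i)" using sub finite_subset by blast
  have d: "deg E i > 0" using fin ne by (simp add: deg_def card_gt_0_iff)
  have z0: "(\<lambda>_. False) \<in> interventions n" and zj: "(\<lambda>k. k = j) \<in> interventions n"
    using jn by (auto simp: interventions_def PiE_dflt_def)
  have "exposure E i (\<lambda>_. False) = 0" by (simp add: exposure_def)
  then have a: "a = a'" using y[OF z0] y'[OF z0] by simp
  have "exposure E i (\<lambda>k. k = j) = 1 / real (deg E i)"
    using fin j by (simp add: exposure_def of_bool_def sum.delta)
  moreover have "b * exposure E i (\<lambda>k. k = j) = b' * exposure E i (\<lambda>k. k = j)"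
    using y[OF zj] y'[OF zj] a ij by auto
  ultimately show "b' = b" using d by simp
qed

end

theory Submission
  imports Defs
begin

text \<open>
  The weight \<open>W\<^sub>i\<close> is the residual of \<open>T\<^sub>i\<^sup>2\<close> after regression on \<open>(1, T\<^sub>i)\<close>, normalised so that
  \<open>E[W\<^sub>i] = E[W\<^sub>i T\<^sub>i] = 0\<close> and \<open>E[W\<^sub>i T\<^sub>i\<^sup>2] = 1\<close>. As \<open>z\<^sub>i\<close> is independent of the exposure, each
  \<open>W\<^sub>i Y\<^sub>i\<^sup>2\<close> is unbiased for \<open>\<beta>\<^sub>i\<^sub>,\<^sub>3\<^sup>2\<close>. The moments of the binomial distribution give
  \<open>E[W\<^sub>i\<^sup>2] = d\<^sub>i\<^sup>3 / (2 p\<^sup>2 (1 - p)\<^sup>2 (d\<^sub>i - 1)) \<le> d\<^sub>i\<^sup>2 / (p (1 - p))\<^sup>2\<close>. The terms of units with disjoint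
  closed neighborhoods are uncorrelated, and at most \<open>(d\<^sub>m\<^sub>a\<^sub>x + 1)\<^sup>2\<close> closed neighborhoods meet a given
  one, so the variance of the estimator is \<open>O(d\<^sub>m\<^sub>a\<^sub>x\<^sup>4 / n)\<close>. Since \<open>\<tau>\<^sup>4 = d\<^sub>m\<^sub>a\<^sub>x\<^sup>5 / n\<close>, Chebyshev's
  inequality bounds the two error probabilities by multiples of \<open>\<tau>\<^sup>2\<close> and \<open>\<tau>\<^sup>4 / \<delta>\<^sup>2\<close>. The null
  model is the case \<open>\<beta>\<^sub>3 = 0\<close> of the linear-in-means model, so one computation covers both.
\<close>

section \<open>Independence and variances of sums under finitely supported pmfs\<close>

lemma expectation_pair_pmf_mult:
  fixes f :: "'a \<Rightarrow> real" and g :: "'b \<Rightarrow> real"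
  assumes "finite (set_pmf M)" "finite (set_pmf N)"
  shows "measure_pmf.expectation (pair_pmf M N) (\<lambda>(x, y). f x * g y) =
    measure_pmf.expectation M f * measure_pmf.expectation N g"
proof -
  have "measure_pmf.expectation (pair_pmf M N) (\<lambda>(x, y). f x * g y) =
      (\<Sum>x\<in>set_pmf M. pmf M x * (\<Sum>y\<in>set_pmf N. pmf N y * (f x * g y)))"
    unfolding pair_pmf_def using assms
    by (subst pmf_expectation_bind[of "set_pmf M"])
       (auto simp: pmf_expectation_bind[of "set_pmf N"])
  also have "\<dots> = (\<Sum>x\<in>set_pmf M. pmf M x * f x) * (\<Sum>y\<in>set_pmf N. pmf N y * g y)"
    unfolding sum_product by (simp add: sum_distrib_left mult_ac)
  also have "(\<Sum>x\<in>set_pmf M. pmf M x * f x) = measure_pmf.expectation M f"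
    using assms by (subst integral_measure_pmf[of "set_pmf M"]) auto
  also have "(\<Sum>y\<in>set_pmf N. pmf N y * g y) = measure_pmf.expectation N g"
    using assms by (subst integral_measure_pmf[of "set_pmf N"]) auto
  finally show ?thesis .
qed

text \<open>A pointwise substitute for measurability with respect to the coordinates in
  \<open>A\<close>. It ranges over all assignments, not only those in a support, so it applies to
  assignments glued from two pieces.\<close>

definition depends_only_on :: "'a set \<Rightarrow> (('a \<Rightarrow> 'b) \<Rightarrow> 'c) \<Rightarrow> bool" where
  "depends_only_on A f \<longleftrightarrow> (\<forall>z z'. (\<forall>k\<in>A. z k = z' k) \<longrightarrow> f z = f z')"

text \<open>The product pmf is a pair of independent pieces on \<open>A\<close> and
  \<open>I - A\<close>; \<open>f\<close> reads only the first piece and, since \<open>B\<close>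
  avoids \<open>A\<close>, \<open>g\<close> reads only the second.\<close>

lemma expectation_Pi_pmf_mult:
  fixes f g :: "('a \<Rightarrow> 'b) \<Rightarrow> real"
  assumes I: "finite I" and fin: "\<And>i. i \<in> I \<Longrightarrow> finite (set_pmf (q i))"
    and A: "A \<subseteq> I" and AB: "A \<inter> B = {}"
    and f: "depends_only_on A f" and g: "depends_only_on B g"
    and B: "B \<subseteq> I"
  shows "measure_pmf.expectation (Pi_pmf I dflt q) (\<lambda>z. f z * g z) =
    measure_pmf.expectation (Pi_pmf I dflt q) f * measure_pmf.expectation (Pi_pmf I dflt q) g"
proof -
  let ?P = "\<lambda>J. Pi_pmf J dflt q"
  have finP: "finite (set_pmf (?P J))" if "J \<subseteq> I" for J
    using that I fin finite_subset[OF that I]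
    by (auto simp: set_Pi_pmf intro!: finite_PiE_dflt)
  have un: "?P I = map_pmf (\<lambda>(f, g) x. if x \<in> A then f x else g x)
      (pair_pmf (?P A) (?P (I - A)))"
    using Pi_pmf_union[of A "I - A" dflt q] I A finite_subset[OF A I]
    by (simp add: Un_absorb1)
  have f': "f (\<lambda>x. if x \<in> A then u x else w x) = f u" for u w
    using f by (simp add: depends_only_on_def)
  have g': "g (\<lambda>x. if x \<in> A then u x else w x) = g w" for u w
    using AB by (intro g[unfolded depends_only_on_def, rule_format]) auto
  \<comment> \<open>Three instances are needed: identities for \<open>F\<close> and \<open>G\<close>
    give the product, and a constant 1 in one place shows that the other expectation is the same
    over a piece as over all of \<open>I\<close>.\<close>
  have pair: "measure_pmf.expectation (?P I) (\<lambda>z. F (f z) * G (g z)) =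
      measure_pmf.expectation (?P A) (\<lambda>z. F (f z)) *
      measure_pmf.expectation (?P (I - A)) (\<lambda>z. G (g z))"
    for F G :: "real \<Rightarrow> real"
    unfolding un integral_map_pmf case_prod_unfold f' g'
    using expectation_pair_pmf_mult[of "?P A" "?P (I - A)" "\<lambda>z. F (f z)" "\<lambda>z. G (g z)"] finP A
    by (simp add: case_prod_unfold)
  show ?thesis
    using pair[of "\<lambda>x. x" "\<lambda>x. x"] pair[of "\<lambda>x. x" "\<lambda>_. 1"] pair[of "\<lambda>_. 1" "\<lambda>x. x"] by simp
qed

text \<open>A dependency graph bound: after expanding the square, only pairs related by
  \<open>R\<close> contribute, each at most \<open>B\<close>, and every index has at most
  \<open>m\<close> partners.\<close>

lemma variance_sum_le:
  fixes X :: "'i \<Rightarrow> 'a \<Rightarrow> real"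
  assumes fin: "finite (set_pmf M)" and I: "finite I" and B: "0 \<le> B"
    and sq: "\<And>i. i \<in> I \<Longrightarrow> measure_pmf.expectation M (\<lambda>z. (X i z)\<^sup>2) \<le> B"
    and uncorr: "\<And>i j. i \<in> I \<Longrightarrow> j \<in> I \<Longrightarrow> \<not> R i j \<Longrightarrow>
      measure_pmf.expectation M (\<lambda>z. X i z * X j z) =
      measure_pmf.expectation M (X i) * measure_pmf.expectation M (X j)"
    and card: "\<And>i. i \<in> I \<Longrightarrow> real (card {j\<in>I. R i j}) \<le> m"
  shows "measure_pmf.variance M (\<lambda>z. \<Sum>i\<in>I. X i z) \<le> real (card I) * m * B"
proof -
  let ?E = "measure_pmf.expectation M"
  define Z where "Z = (\<lambda>i z. X i z - ?E (X i))"
  have int [simp]: "integrable M f" for f :: "'a \<Rightarrow> real"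
    by (rule integrable_measure_pmf_finite[OF fin])
  have Z2: "?E (\<lambda>z. (Z i z)\<^sup>2) \<le> B" if "i \<in> I" for i
  proof -
    have "?E (\<lambda>z. (Z i z)\<^sup>2) = ?E (\<lambda>z. (X i z)\<^sup>2) - (?E (X i))\<^sup>2"
      unfolding Z_def by (rule measure_pmf.variance_eq) simp_all
    then show ?thesis using sq[OF that] by (smt (verit) zero_le_power2)
  qed
  have ZZ: "?E (\<lambda>z. Z i z * Z j z) \<le> (if R i j then B else 0)" if "i \<in> I" "j \<in> I" for i j
  proof (cases "R i j")
    case True
    \<comment> \<open>The arithmetic-geometric mean inequality takes the place of Cauchy-Schwarz, as
      both second moments have the same bound \<open>B\<close>.\<close>
    have "?E (\<lambda>z. Z i z * Z j z) \<le> ?E (\<lambda>z. ((Z i z)\<^sup>2 + (Z j z)\<^sup>2) / 2)"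
    proof (rule integral_mono)
      fix z
      have "0 \<le> (Z i z - Z j z)\<^sup>2" by simp
      then show "Z i z * Z j z \<le> ((Z i z)\<^sup>2 + (Z j z)\<^sup>2) / 2"
        by (simp add: power2_diff)
    qed simp_all
    also have "\<dots> = (?E (\<lambda>z. (Z i z)\<^sup>2) + ?E (\<lambda>z. (Z j z)\<^sup>2)) / 2" by simp
    also have "\<dots> \<le> B" using Z2[OF that(1)] Z2[OF that(2)] by simp
    finally show ?thesis using True by simp
  next
    case False
    have "?E (\<lambda>z. Z i z * Z j z) = ?E (\<lambda>z. X i z * X j z) - ?E (X i) * ?E (X j)"
      unfolding Z_def by (simp add: left_diff_distrib right_diff_distrib)
    then show ?thesis using uncorr[OF that False] False by simp
  qed
  have "measure_pmf.variance M (\<lambda>z. \<Sum>i\<in>I. X i z) = ?E (\<lambda>z. (\<Sum>i\<in>I. Z i z)\<^sup>2)"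
    by (simp add: Z_def sum_subtractf)
  also have "\<dots> = (\<Sum>i\<in>I. \<Sum>j\<in>I. ?E (\<lambda>z. Z i z * Z j z))"
    by (simp add: power2_eq_square sum_product)
  also have "\<dots> \<le> (\<Sum>i\<in>I. \<Sum>j\<in>I. if R i j then B else 0)"
    by (intro sum_mono ZZ)
  also have "\<dots> = (\<Sum>i\<in>I. real (card {j\<in>I. R i j}) * B)"
    using I by (simp add: sum.If_cases Int_def conj_commute)
  also have "\<dots> \<le> (\<Sum>i\<in>I. m * B)"
    by (intro sum_mono mult_right_mono card B)
  finally show ?thesis by simp
qed

section \<open>Moments of the binomial distribution\<close>

text \<open>Conditioning on one trial: a success shifts the count by one.\<close>

lemma expectation_binomial_pmf_Suc:
  fixes f :: "nat \<Rightarrow> real"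
  assumes "0 \<le> p" "p \<le> 1"
  shows "measure_pmf.expectation (binomial_pmf (Suc n) p) f =
    p * measure_pmf.expectation (binomial_pmf n p) (\<lambda>k. f (Suc k)) +
    (1 - p) * measure_pmf.expectation (binomial_pmf n p) f"
proof -
  have "finite (set_pmf (binomial_pmf n p))"
    using assms by (intro finite_set_pmf_binomial_pmf) simp
  then show ?thesis
    using assms
    by (simp add: binomial_pmf_Suc, subst pmf_expectation_bind[of UNIV])
       (auto simp: UNIV_bool map_pmf_def[symmetric])
qed

text \<open>The coefficients 1, 3, 1 and 1, 7, 6, 1 are Stirling numbers of the second kind,
  multiplying falling factorials of \<open>n\<close>. Subtraction is on \<open>real\<close>, so
  small \<open>n\<close> needs no separate treatment. The four moments go through one induction
  because each increment involves the lower moments.\<close>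

lemma binomial_moments:
  fixes n :: nat and p :: real
  assumes p: "0 \<le> p" "p \<le> 1"
  defines "M \<equiv> \<lambda>n j::nat. measure_pmf.expectation (binomial_pmf n p) (\<lambda>k. real k ^ j)"
  shows "M n 1 = n * p"
    and "M n 2 = n * p + n * (real n - 1) * p ^ 2"
    and "M n 3 = n * p + 3 * real n * (real n - 1) * p ^ 2 + n * (real n - 1) * (real n - 2) * p ^ 3"
    and "M n 4 = n * p + 7 * real n * (real n - 1) * p ^ 2 + 6 * real n * (real n - 1) * (real n - 2) * p ^ 3
           + n * (real n - 1) * (real n - 2) * (real n - 3) * p ^ 4"
proof -
  have fin: "integrable (binomial_pmf n p) f" for n and f :: "nat \<Rightarrow> real"
    using p by (intro integrable_measure_pmf_finite) (simp add: finite_set_pmf_binomial_pmf)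
  have pw: "(1 + x) ^ 2 = x ^ 2 + 2 * x + 1" "(1 + x) ^ 3 = x ^ 3 + 3 * x ^ 2 + 3 * x + 1"
    "(1 + x) ^ 4 = x ^ 4 + 4 * x ^ 3 + 6 * x ^ 2 + 4 * x + 1" for x :: real
    by (simp_all add: algebra_simps power2_eq_square power3_eq_cube power4_eq_xxxx)
  have step: "M (Suc n) 1 = M n 1 + p"
     "M (Suc n) 2 = M n 2 + p * (2 * M n 1 + 1)"
     "M (Suc n) 3 = M n 3 + p * (3 * M n 2 + 3 * M n 1 + 1)"
     "M (Suc n) 4 = M n 4 + p * (4 * M n 3 + 6 * M n 2 + 4 * M n 1 + 1)" for n
    unfolding M_def expectation_binomial_pmf_Suc[OF p]
    using fin by (simp_all add: pw algebra_simps)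
  have "M n 1 = n * p \<and>
    M n 2 = n * p + n * (real n - 1) * p ^ 2 \<and>
    M n 3 = n * p + 3 * real n * (real n - 1) * p ^ 2 + n * (real n - 1) * (real n - 2) * p ^ 3 \<and>
    M n 4 = n * p + 7 * real n * (real n - 1) * p ^ 2 + 6 * real n * (real n - 1) * (real n - 2) * p ^ 3
           + n * (real n - 1) * (real n - 2) * (real n - 3) * p ^ 4"
  proof (induction n)
    case 0
    then show ?case using p by (simp add: M_def binomial_pmf_0)
  next
    case (Suc n)
    note IH = conjunct1[OF Suc] conjunct1[OF conjunct2[OF Suc]]
      conjunct1[OF conjunct2[OF conjunct2[OF Suc]]] conjunct2[OF conjunct2[OF conjunct2[OF Suc]]]
    show ?case
      unfolding step IH by (simp add: algebra_simps power2_eq_square power3_eq_cube power4_eq_xxxx)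
  qed
  then show "M n 1 = n * p"
    and "M n 2 = n * p + n * (real n - 1) * p ^ 2"
    and "M n 3 = n * p + 3 * real n * (real n - 1) * p ^ 2 + n * (real n - 1) * (real n - 2) * p ^ 3"
    and "M n 4 = n * p + 7 * real n * (real n - 1) * p ^ 2 + 6 * real n * (real n - 1) * (real n - 2) * p ^ 3
           + n * (real n - 1) * (real n - 2) * (real n - 3) * p ^ 4"
    by blast+
qed

section \<open>The Bernoulli design and the binomial law of treated counts\<close>

lemma finite_set_bernoulli_design: "finite (set_pmf (bernoulli_design n p))"
  unfolding bernoulli_design_def by (auto simp: set_Pi_pmf intro!: finite_PiE_dflt)

lemma integrable_bernoulli_design [simp]:
  "integrable (measure_pmf (bernoulli_design n p)) (f :: _ \<Rightarrow> real)"
  by (rule integrable_measure_pmf_finite[OF finite_set_bernoulli_design])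

lemma bernoulli_design_in_interventions:
  "z \<in> set_pmf (bernoulli_design n p) \<Longrightarrow> z \<in> interventions n"
  unfolding bernoulli_design_def interventions_def by (auto simp: set_Pi_pmf PiE_dflt_def)

lemma expectation_bernoulli_design_mult:
  fixes f g :: "(nat \<Rightarrow> bool) \<Rightarrow> real"
  assumes "A \<subseteq> {..<n}" "B \<subseteq> {..<n}" "A \<inter> B = {}" "depends_only_on A f" "depends_only_on B g"
  shows "measure_pmf.expectation (bernoulli_design n p) (\<lambda>z. f z * g z) =
    measure_pmf.expectation (bernoulli_design n p) f * measure_pmf.expectation (bernoulli_design n p) g"
  unfolding bernoulli_design_def using assms by (intro expectation_Pi_pmf_mult[where A = A and B = B]) auto

lemma expectation_bernoulli_design_card:
  fixes f :: "nat \<Rightarrow> real"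
  assumes "A \<subseteq> {..<n}" "0 \<le> p" "p \<le> 1"
  shows "measure_pmf.expectation (bernoulli_design n p) (\<lambda>z. f (card {k\<in>A. z k})) =
    measure_pmf.expectation (binomial_pmf (card A) p) f"
proof -
  \<comment> \<open>Projecting the design to \<open>A\<close> resets the other coordinates to the
    default \<open>False\<close>, which the count over \<open>A\<close> does not see.\<close>
  have *: "{k\<in>A. if k \<in> A then z k else False} = {k\<in>A. z k}" for z by auto
  have "finite A" using assms finite_subset by blast
  then show ?thesis
    using assms
    unfolding bernoulli_design_def
    by (subst binomial_pmf_altdef'[of A _ p False])
       (auto simp: Pi_pmf_subset[of "{..<n}" A] map_pmf_comp *)
qed

text \<open>The two quantities are the variance of the exposure and the denominator of the weight.\<close>

lemma binomial_fraction_moments: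
  fixes d :: nat and p :: real
  assumes p: "0 \<le> p" "p \<le> 1" and d: "d > 0"
  defines "m \<equiv> \<lambda>j::nat. measure_pmf.expectation (binomial_pmf d p) (\<lambda>k. (real k / real d) ^ j)"
  defines "v \<equiv> p * (1 - p)"
  shows "m 2 - (m 1)\<^sup>2 = v / d"
    and "(m 2 - (m 1)\<^sup>2) * (m 4 - (m 2)\<^sup>2) - (m 3 - m 2 * m 1)\<^sup>2 = 2 * v ^ 3 * (real d - 1) / real d ^ 4"
proof -
  \<comment> \<open>In terms of \<open>x\<close> the moments become polynomials in \<open>p\<close>
    and \<open>x\<close>: each factor \<open>d - c\<close> of a falling factorial absorbs one
    \<open>x\<close>.\<close>
  define x where "x = 1 / real d"
  have dx: "real d * x = 1" using d by (simp add: x_def)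
  have m: "m j = measure_pmf.expectation (binomial_pmf d p) (\<lambda>k. real k ^ j) * x ^ j" for j
    by (simp add: m_def x_def power_divide)
  have pull: "(real d - c) * x = 1 - c * x" for c
    using dx by (simp add: left_diff_distrib)
  have m1: "m 1 = p"
    unfolding m binomial_moments[OF p] using dx by simp
  have "m 2 = p * x * (d * x) + (d * x) * ((real d - 1) * x) * p ^ 2"
    unfolding m binomial_moments[OF p] by (simp add: algebra_simps power2_eq_square)
  then have m2: "m 2 = p * x + (1 - x) * p ^ 2"
    unfolding dx pull by simp
  have "m 3 = p * x ^ 2 * (d * x) + 3 * x * (d * x) * ((real d - 1) * x) * p ^ 2
      + (d * x) * ((real d - 1) * x) * ((real d - 2) * x) * p ^ 3"
    unfolding m binomial_moments[OF p] by (simp only: power2_eq_square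
      power3_eq_cube power4_eq_xxxx distrib_left distrib_right mult_ac)
  then have m3: "m 3 = p * x ^ 2 + 3 * x * (1 - x) * p ^ 2 + (1 - x) * (1 - 2 * x) * p ^ 3"
    unfolding dx pull by simp
  have "m 4 = p * x ^ 3 * (d * x) + 7 * x ^ 2 * (d * x) * ((real d - 1) * x) * p ^ 2
      + 6 * x * (d * x) * ((real d - 1) * x) * ((real d - 2) * x) * p ^ 3
      + (d * x) * ((real d - 1) * x) * ((real d - 2) * x) * ((real d - 3) * x) * p ^ 4"
    unfolding m binomial_moments[OF p] by (simp only: power2_eq_square
      power3_eq_cube power4_eq_xxxx distrib_left distrib_right mult_ac)
  then have m4: "m 4 = p * x ^ 3 + 7 * x ^ 2 * (1 - x) * p ^ 2 + 6 * x * (1 - x) * (1 - 2 * x) * p ^ 3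
      + (1 - x) * (1 - 2 * x) * (1 - 3 * x) * p ^ 4"
    unfolding dx pull by simp
  have "m 2 - (m 1)\<^sup>2 = v * x"
    unfolding m1 m2 v_def by (simp add: algebra_simps power2_eq_square)
  then show 1: "m 2 - (m 1)\<^sup>2 = v / d" by (simp add: x_def)
  have 2: "m 3 - m 2 * m 1 = 2 * p * v * x + v * (1 - 2 * p) * x ^ 2"
    unfolding m1 m2 m3 v_def by (simp add: algebra_simps power2_eq_square power3_eq_cube)
  have 3: "m 4 - (m 2)\<^sup>2 = 4 * p\<^sup>2 * v * x + (4 * p * v * (1 - 2 * p) + 2 * v\<^sup>2) * x ^ 2
      + v * (1 - 6 * v) * x ^ 3"
    unfolding m2 m4 v_def by (simp add: algebra_simps power2_eq_square power3_eq_cube power4_eq_xxxx)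
  \<comment> \<open>Both products have leading term
    \<open>4 * p\<^sup>2 * v\<^sup>2 * x\<^sup>2\<close>, which cancels and leaves order
    \<open>x ^ 3\<close>. The coefficient of the next order simplifies by
    \<open>(1 - 2 * p)\<^sup>2 = 1 - 4 * v\<close>.\<close>
  have "(m 2 - (m 1)\<^sup>2) * (m 4 - (m 2)\<^sup>2) - (m 3 - m 2 * m 1)\<^sup>2 =
      v\<^sup>2 * x ^ 3 * (2 * v + (1 - 6 * v - (1 - 2 * p)\<^sup>2) * x)"
    unfolding \<open>m 2 - (m 1)\<^sup>2 = v * x\<close> 2 3
    by (simp add: algebra_simps power2_eq_square power3_eq_cube)
  also have "1 - 6 * v - (1 - 2 * p)\<^sup>2 = - 2 * v"
    by (simp add: v_def power2_eq_square algebra_simps)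
  also have "v\<^sup>2 * x ^ 3 * (2 * v + (- 2 * v) * x) = 2 * v ^ 3 * (1 - x) * x ^ 3"
    by (simp add: algebra_simps power2_eq_square power3_eq_cube)
  also have "1 - x = (real d - 1) * x" unfolding pull by simp
  also have "2 * v ^ 3 * ((real d - 1) * x) * x ^ 3 = 2 * v ^ 3 * (real d - 1) / real d ^ 4"
    by (simp add: x_def power_divide power_numeral_reduce)
  finally show "(m 2 - (m 1)\<^sup>2) * (m 4 - (m 2)\<^sup>2) - (m 3 - m 2 * m 1)\<^sup>2 = 2 * v ^ 3 * (real d - 1) / real d ^ 4" .
qed

section \<open>Exposures and moments of the weights\<close>

lemma neighbors_subset:
  "network n E \<Longrightarrow> neighbors E i \<subseteq> {..<n}"
  by (auto simp: network_def neighbors_def)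

lemma finite_neighbors: "network n E \<Longrightarrow> finite (neighbors E i)"
  by (rule finite_subset[OF neighbors_subset finite_lessThan])

lemma exposure_eq_card:
  assumes "network n E"
  shows "exposure E i z = card {j \<in> neighbors E i. z j} / deg E i"
  using finite_neighbors[OF assms]
  by (simp add: exposure_def of_bool_def sum.If_cases Int_def)


lemma depends_only_onI:
  "(\<And>z z'. (\<And>k. k \<in> A \<Longrightarrow> z k = z' k) \<Longrightarrow> f z = f z') \<Longrightarrow> depends_only_on A f"
  unfolding depends_only_on_def by blast

lemma exposure_cong:
  "(\<And>k. k \<in> neighbors E i \<Longrightarrow> z k = z' k) \<Longrightarrow> exposure E i z = exposure E i z'"
  by (simp add: exposure_def)

lemma weight_cong:
  assumes "\<And>k. k \<in> neighbors E i \<Longrightarrow> z k = z' k"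
  shows "weight D E i z = weight D E i z'"
proof -
  have "exposure E i z = exposure E i z'" using assms by (rule exposure_cong)
  then show ?thesis by (simp only: weight_def)
qed

text \<open>Here \<open>c\<close> is the covariance of \<open>T\<close> and
  \<open>T\<^sup>2\<close>, and \<open>\<Delta>\<close> is the determinant of their covariance
  matrix. The residual of the regression has variance \<open>\<Delta> / V\<close>, and the weight is
  \<open>V / \<Delta>\<close> times that residual, so its second moment is exactly
  \<open>V / \<Delta>\<close>.\<close>

lemma weight_moments:
  fixes n i :: nat and p :: real
  assumes p: "0 < p" "p < 1" and net: "network n E" and d: "deg E i \<ge> 2"
  defines "D \<equiv> bernoulli_design n p"
  defines mu_def: "\<mu> \<equiv> measure_pmf.expectation D"
  shows "\<mu> (weight D E i) = 0"
    and "\<mu> (\<lambda>z. weight D E i z * exposure E i z) = 0"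
    and "\<mu> (\<lambda>z. weight D E i z * (exposure E i z)\<^sup>2) = 1"
    and "\<mu> (\<lambda>z. (weight D E i z)\<^sup>2) \<le> (real (deg E i))\<^sup>2 / (p * (1 - p))\<^sup>2"
proof -
  define d where "d = deg E i"
  define T where "T = exposure E i"
  define m where "m = (\<lambda>k::nat. \<mu> (\<lambda>z. T z ^ k))"
  define V where "V = m 2 - (m 1)\<^sup>2"
  define c where "c = m 3 - m 2 * m 1"
  define \<Delta> where "\<Delta> = V * (m 4 - (m 2)\<^sup>2) - c\<^sup>2"
  define v where "v = p * (1 - p)"
  have v: "v > 0" using p by (simp add: v_def)
  have d2: "real d \<ge> 2" using d by (simp add: d_def)
  have m: "m j = measure_pmf.expectation (binomial_pmf d p) (\<lambda>k. (real k / real d) ^ j)" for j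
    unfolding m_def mu_def D_def T_def exposure_eq_card[OF net]
    using expectation_bernoulli_design_card[of "neighbors E i" n p "\<lambda>k. (real k / real d) ^ j"]
      neighbors_subset[OF net] p
    by (simp add: d_def deg_def)
  have V: "V = v / d" and \<Delta>: "\<Delta> = 2 * v ^ 3 * (real d - 1) / real d ^ 4"
    using binomial_fraction_moments[of p d] p d2
    unfolding V_def \<Delta>_def c_def m v_def by auto
  \<comment> \<open>This uses degree at least 2. With a single neighbor, \<open>T\<close> would take
    only the values 0 and 1, so \<open>T\<^sup>2 = T\<close> and the determinant would
    vanish.\<close>
  have \<Delta>0: "\<Delta> > 0" using \<Delta> v d2 by simp
  have int: "integrable (measure_pmf D) f" for f :: "_ \<Rightarrow> real"
    by (simp add: D_def)
  have W: "weight D E i z = (V * ((T z)\<^sup>2 - m 2) - c * (T z - m 1)) / \<Delta>" for z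
  proof -
    have "measure_pmf.variance D T = V"
      unfolding V_def m_def mu_def by (subst measure_pmf.variance_eq) (simp_all add: int)
    then show ?thesis
      unfolding weight_def Let_def \<Delta>_def c_def m_def mu_def T_def by simp
  qed
  \<comment> \<open>Every claim below is the mean of a polynomial of degree at most 4 in
    \<open>T\<close>; each is brought to this shape, with zero coefficients written out.\<close>
  have lin: "\<mu> (\<lambda>z. a * T z ^ 4 + b * T z ^ 3 + e * T z ^ 2 + f * T z + g) =
     a * m 4 + b * m 3 + e * m 2 + f * m 1 + g" for a b e f g
    unfolding mu_def m_def using int by simp
  note norm = field_simps power2_eq_square power3_eq_cube power4_eq_xxxx
  have "\<mu> (weight D E i) =
      \<mu> (\<lambda>z. 0 * T z ^ 4 + 0 * T z ^ 3 + (V/\<Delta>) * T z ^ 2 + (-c/\<Delta>) * T z + (c * m 1 - V * m 2) / \<Delta>)"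
    using \<Delta>0 by (intro arg_cong[where f = \<mu>] ext) (simp add: W norm)
  then show "\<mu> (weight D E i) = 0"
    unfolding lin using \<Delta>0 by (simp add: field_simps)
  have "\<mu> (\<lambda>z. weight D E i z * T z) =
      \<mu> (\<lambda>z. 0 * T z ^ 4 + (V/\<Delta>) * T z ^ 3 + (-c/\<Delta>) * T z ^ 2 + (c * m 1 - V * m 2) / \<Delta> * T z + 0)"
    using \<Delta>0 by (intro arg_cong[where f = \<mu>] ext) (simp add: W norm)
  also have "\<dots> = (V * (m 3 - m 2 * m 1) - c * (m 2 - (m 1)\<^sup>2)) / \<Delta>"
    unfolding lin using \<Delta>0 by (simp add: norm)
  also have "\<dots> = 0" unfolding V_def[symmetric] c_def[symmetric] by simp
  finally show "\<mu> (\<lambda>z. weight D E i z * exposure E i z) = 0" by (simp add: T_def)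
  have "\<mu> (\<lambda>z. weight D E i z * (T z)\<^sup>2) =
      \<mu> (\<lambda>z. (V/\<Delta>) * T z ^ 4 + (-c/\<Delta>) * T z ^ 3 + (c * m 1 - V * m 2) / \<Delta> * T z ^ 2 + 0 * T z + 0)"
    using \<Delta>0 by (intro arg_cong[where f = \<mu>] ext) (simp add: W norm)
  also have "\<dots> = (V * (m 4 - (m 2)\<^sup>2) - c * (m 3 - m 2 * m 1)) / \<Delta>"
    unfolding lin using \<Delta>0 by (simp add: norm)
  also have "\<dots> = 1" unfolding c_def[symmetric] using \<Delta>0 by (simp add: \<Delta>_def power2_eq_square)
  finally show "\<mu> (\<lambda>z. weight D E i z * (exposure E i z)\<^sup>2) = 1" by (simp add: T_def)
  \<comment> \<open>The constant term: \<open>\<Delta>\<close> times the weight is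
    \<open>V * T\<^sup>2 - c * T + h\<close>.\<close>
  define h where "h = c * m 1 - V * m 2"
  have "\<mu> (\<lambda>z. (weight D E i z)\<^sup>2) = \<mu> (\<lambda>z. (V\<^sup>2/\<Delta>\<^sup>2) * T z ^ 4 + (-2*V*c/\<Delta>\<^sup>2) * T z ^ 3 +
      (c\<^sup>2 + 2 * V * h) / \<Delta>\<^sup>2 * T z ^ 2 + (-2 * c * h / \<Delta>\<^sup>2) * T z + h\<^sup>2/\<Delta>\<^sup>2)"
    using \<Delta>0 by (intro arg_cong[where f = \<mu>] ext) (simp add: W h_def norm)
  also have "\<dots> = (V\<^sup>2 * (m 4 - (m 2)\<^sup>2) - 2 * V * c * (m 3 - m 2 * m 1) + c\<^sup>2 * (m 2 - (m 1)\<^sup>2)) / \<Delta>\<^sup>2"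
    unfolding lin h_def using \<Delta>0 by (simp add: norm)
  also have "\<dots> = V * \<Delta> / \<Delta>\<^sup>2"
    unfolding V_def[symmetric] c_def[symmetric] \<Delta>_def by (simp add: algebra_simps power2_eq_square)
  also have "\<dots> = V / \<Delta>" using \<Delta>0 by (simp add: power2_eq_square)
  also have "\<dots> = real d ^ 3 / (2 * v\<^sup>2 * (real d - 1))"
    unfolding V \<Delta> using v d2 by (simp add: norm)
  \<comment> \<open>Uses \<open>2 * (d - 1) \<ge> d\<close>, that is, degree at least 2.\<close>
  also have "\<dots> \<le> real d ^ 3 / (v\<^sup>2 * real d)"
    using v d2 by (intro divide_left_mono) (auto simp: mult_pos_pos)
  also have "\<dots> = (real d)\<^sup>2 / v\<^sup>2" using d2 by (simp add: norm)
  finally show "\<mu> (\<lambda>z. (weight D E i z)\<^sup>2) \<le> (real (deg E i))\<^sup>2 / (p * (1 - p))\<^sup>2"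
    by (simp add: d_def v_def)
qed

section \<open>Overlaps of closed neighborhoods\<close>

text \<open>The coordinates of the intervention on which the term of unit \<open>i\<close> in the
  estimator depends: its own treatment and its exposure.\<close>

definition closed_neighborhood :: "(nat \<times> nat) set \<Rightarrow> nat \<Rightarrow> nat set" where
  "closed_neighborhood E i = insert i (neighbors E i)"

lemma max_deg_ge: "i < n \<Longrightarrow> deg E i \<le> max_deg n E"
  unfolding max_deg_def by (intro Max_ge) auto

text \<open>If the neighborhoods of \<open>i\<close> and \<open>j\<close> share \<open>k\<close>,
  then by symmetry of the network \<open>j\<close> lies in the closed neighborhood of
  \<open>k\<close>. Hence \<open>j\<close> is within two steps of \<open>i\<close>, and a union
  bound applies.\<close>

lemma card_overlapping_neighborhoods:
  assumes net: "network n E" and i: "i < n"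
  shows "card {j\<in>{..<n}. closed_neighborhood E i \<inter> closed_neighborhood E j \<noteq> {}} \<le> (max_deg n E + 1)\<^sup>2"
proof -
  have card: "card (closed_neighborhood E k) \<le> max_deg n E + 1" if "k < n" for k
    using max_deg_ge[OF that, of E] finite_neighbors[OF net, of k]
    by (auto simp: closed_neighborhood_def deg_def card_insert_if)
  have fin: "finite (closed_neighborhood E k)" for k
    using finite_neighbors[OF net] by (simp add: closed_neighborhood_def)
  have lt: "k < n" if "k \<in> closed_neighborhood E i" for k
    using that i neighbors_subset[OF net, of i] by (auto simp: closed_neighborhood_def)
  have "{j\<in>{..<n}. closed_neighborhood E i \<inter> closed_neighborhood E j \<noteq> {}}
      \<subseteq> (\<Union>k\<in>closed_neighborhood E i. closed_neighborhood E k)"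
    using net by (auto simp: closed_neighborhood_def neighbors_def network_def sym_def)
  then have "card {j\<in>{..<n}. closed_neighborhood E i \<inter> closed_neighborhood E j \<noteq> {}}
      \<le> card (\<Union>k\<in>closed_neighborhood E i. closed_neighborhood E k)"
    using fin by (intro card_mono) auto
  also have "\<dots> \<le> (\<Sum>k\<in>closed_neighborhood E i. card (closed_neighborhood E k))"
    using fin by (intro card_UN_le)
  also have "\<dots> \<le> (\<Sum>k\<in>closed_neighborhood E i. max_deg n E + 1)"
    by (intro sum_mono card lt)
  also have "\<dots> = card (closed_neighborhood E i) * (max_deg n E + 1)" by simp
  also have "\<dots> \<le> (max_deg n E + 1) * (max_deg n E + 1)"
    using card[OF i] by (rule mult_le_mono1)
  finally show ?thesis by (simp only: power2_eq_square)
qed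

section \<open>Mean and variance of the estimator\<close>

lemma finite_interventions: "finite (interventions n)"
  unfolding interventions_def by (intro finite_PiE_dflt) auto

lemma abs_outcome_le:
  assumes "outcome_norm n y \<le> B" "i < n" "z \<in> interventions n"
  shows "\<bar>y z i\<bar> \<le> B"
proof -
  have "\<bar>y z i\<bar> \<in> (\<lambda>(i, z). \<bar>y z i\<bar>) ` ({..<n} \<times> interventions n)"
    using assms by force
  then have "\<bar>y z i\<bar> \<le> outcome_norm n y"
    unfolding outcome_norm_def using finite_interventions by (intro Max_ge) auto
  then show ?thesis using assms by simp
qed

lemma expectation_bernoulli_design_cong:
  fixes f g :: "(nat \<Rightarrow> bool) \<Rightarrow> real"
  assumes "\<And>z. z \<in> interventions n \<Longrightarrow> f z = g z"
  shows "measure_pmf.expectation (bernoulli_design n p) f =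
    measure_pmf.expectation (bernoulli_design n p) g"
  using assms by (intro integral_cong_AE) (auto simp: AE_measure_pmf_iff bernoulli_design_in_interventions)

lemma expectation_bernoulli_design_mono:
  fixes f g :: "(nat \<Rightarrow> bool) \<Rightarrow> real"
  assumes "\<And>z. z \<in> interventions n \<Longrightarrow> f z \<le> g z"
  shows "measure_pmf.expectation (bernoulli_design n p) f
    \<le> measure_pmf.expectation (bernoulli_design n p) g"
  using assms by (intro integral_mono_AE) (auto simp: AE_measure_pmf_iff bernoulli_design_in_interventions)

lemma expectation_weight_times_linear_square:
  fixes a b c p :: real
  assumes p: "0 < p" "p < 1" and net: "network n E" and i: "i < n" and d: "deg E i \<ge> 2"
  shows "measure_pmf.expectation (bernoulli_design n p)
    (\<lambda>z. weight (bernoulli_design n p) E i z * (a + b * of_bool (z i) + c * exposure E i z)\<^sup>2) = c\<^sup>2"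
proof -
  define D where "D = bernoulli_design n p"
  define \<mu> :: "((nat \<Rightarrow> bool) \<Rightarrow> real) \<Rightarrow> real" where "\<mu> = measure_pmf.expectation D"
  define W where "W = weight D E i"
  define T where "T = exposure E i"
  define u where "u = (\<lambda>z. a + b * of_bool (z i))"
  note moments = weight_moments[OF p net d, folded D_def, folded \<mu>_def W_def T_def]
  \<comment> \<open>The absence of self-loops enters here: \<open>i\<close> is not among its own
    neighbors.\<close>
  have indep: "\<mu> (\<lambda>z. f (z i) * g z) = \<mu> (\<lambda>z. f (z i)) * \<mu> g"
    if "depends_only_on (neighbors E i) g" for f :: "bool \<Rightarrow> real" and g
    unfolding \<mu>_def D_def using net i that neighbors_subset[OF net, of i]
    by (intro expectation_bernoulli_design_mult[where A = "{i}" and B = "neighbors E i"])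
       (auto simp: depends_only_on_def network_def irrefl_def neighbors_def)
  have dep: "depends_only_on (neighbors E i) W" "depends_only_on (neighbors E i) (\<lambda>z. W z * T z)"
    unfolding W_def T_def depends_only_on_def
    using weight_cong[of E i _ _ D] exposure_cong[of E i] by (metis, metis)
  \<comment> \<open>The grouping separates the factor in \<open>z i\<close> from the factor in the
    exposure. The first two terms then vanish by independence, and the last has mean
    \<open>c\<^sup>2\<close>.\<close>
  have "\<mu> (\<lambda>z. W z * (u z + c * T z)\<^sup>2) =
      \<mu> (\<lambda>z. (u z)\<^sup>2 * W z + 2 * c * (u z * (W z * T z)) + c\<^sup>2 * (W z * (T z)\<^sup>2))"
    by (intro arg_cong[where f = \<mu>] ext) (simp add: algebra_simps power2_eq_square)
  also have "\<dots> = \<mu> (\<lambda>z. (u z)\<^sup>2 * W z) + 2 * c * \<mu> (\<lambda>z. u z * (W z * T z)) + c\<^sup>2 * \<mu> (\<lambda>z. W z * (T z)\<^sup>2)"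
    unfolding \<mu>_def D_def by simp
  also have "\<dots> = c\<^sup>2"
    using indep[OF dep(1), of "\<lambda>t. (a + b * of_bool t)\<^sup>2"] indep[OF dep(2), of "\<lambda>t. a + b * of_bool t"]
      moments by (simp add: u_def)
  finally show ?thesis by (simp add: u_def \<mu>_def W_def T_def D_def)
qed

lemma g_hat_mean_variance:
  fixes n :: nat and p :: real
  assumes p: "0 < p" "p < 1" and n: "n > 0" and net: "network n E"
    and deg: "\<And>i. i < n \<Longrightarrow> deg E i \<ge> 2"
    and y: "y \<in> linear_in_means_model n E"
  defines "D \<equiv> bernoulli_design n p"
  defines "G \<equiv> \<lambda>z. g_hat n D E z (y z)"
  shows "measure_pmf.expectation D G = separation n E y"
    and "measure_pmf.variance D G \<le> 4 / (p * (1 - p))\<^sup>2 * (real (max_deg n E) ^ 5 / real n)"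
proof -
  obtain \<beta>1 \<beta>2 \<beta>3 where
    yi: "\<And>i z. i < n \<Longrightarrow> z \<in> interventions n \<Longrightarrow>
        y z i = \<beta>1 i + \<beta>2 i * of_bool (z i) + \<beta>3 i * exposure E i z"
    and norm: "outcome_norm n y \<le> 1"
    using y unfolding linear_in_means_model_def by blast
  \<comment> \<open>\<open>X\<close> uses the linear formula instead of \<open>y\<close>, whose
    values are prescribed only on \<open>interventions n\<close>. So \<open>X i\<close> depends only
    on the closed neighborhood of \<open>i\<close> at every assignment.\<close>
  define X where "X = (\<lambda>i z. weight D E i z *
      (\<beta>1 i + \<beta>2 i * of_bool (z i) + \<beta>3 i * exposure E i z)\<^sup>2)"
  define \<mu> :: "((nat \<Rightarrow> bool) \<Rightarrow> real) \<Rightarrow> real" where "\<mu> = measure_pmf.expectation D"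
  define B where "B = (real (max_deg n E))\<^sup>2 / (p * (1 - p))\<^sup>2"
  define R where "R = (\<lambda>i j. closed_neighborhood E i \<inter> closed_neighborhood E j \<noteq> {})"
  have G: "G z = (\<Sum>i<n. X i z) / real n" if "z \<in> interventions n" for z
    unfolding G_def g_hat_def X_def using that by (simp add: yi)
  have \<mu>_cong: "\<mu> f = \<mu> g" if "\<And>z. z \<in> interventions n \<Longrightarrow> f z = g z" for f g
    unfolding \<mu>_def D_def by (intro expectation_bernoulli_design_cong that)
  have coeff: "interference_coeff n E y i = \<beta>3 i" if "i < n" for i
    using net that deg[OF that] yi[OF that]
    by (intro interference_coeff_eq) (auto simp: deg_def)
  have mean: "\<mu> G = (\<Sum>i<n. \<mu> (X i)) / real n"
  proof -
    have "\<mu> G = \<mu> (\<lambda>z. (\<Sum>i<n. X i z) / real n)" by (rule \<mu>_cong) (rule G)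
    then show ?thesis by (simp add: \<mu>_def D_def)
  qed
  have "\<mu> G = (\<Sum>i<n. (\<beta>3 i)\<^sup>2) / real n"
    unfolding mean using expectation_weight_times_linear_square[OF p net _ deg]
    by (simp add: X_def \<mu>_def D_def)
  then show "measure_pmf.expectation D G = separation n E y"
    by (simp add: separation_def coeff \<mu>_def)
  have "max_deg n E \<ge> 2" using deg[OF n] max_deg_ge[OF n, of E] by simp
  then have d: "real (max_deg n E) \<ge> 1" by simp
  have sq: "\<mu> (\<lambda>z. (X i z)\<^sup>2) \<le> B" if i: "i < n" for i
  proof -
    have "\<mu> (\<lambda>z. (X i z)\<^sup>2) \<le> \<mu> (\<lambda>z. (weight D E i z)\<^sup>2)"
      unfolding \<mu>_def D_def
    proof (rule expectation_bernoulli_design_mono)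
      fix z assume z: "z \<in> interventions n"
      have "X i z = weight D E i z * (y z i)\<^sup>2" using yi[OF i z] by (simp add: X_def)
      \<comment> \<open>The outcome bound makes the fourth power at most 1, so only the weight
        matters.\<close>
      then have "(X i z)\<^sup>2 = (weight D E i z)\<^sup>2 * (y z i) ^ 4"
        by (simp add: power_mult_distrib)
      also have "\<dots> \<le> (weight D E i z)\<^sup>2 * 1"
        using power_le_one[of "\<bar>y z i\<bar>" 4] abs_outcome_le[OF norm i z]
        by (intro mult_left_mono) (auto simp: power_even_abs)
      finally show "(X i z)\<^sup>2 \<le> (weight (bernoulli_design n p) E i z)\<^sup>2" by (simp add: D_def)
    qed
    also have "\<dots> \<le> (real (deg E i))\<^sup>2 / (p * (1 - p))\<^sup>2"
      unfolding \<mu>_def D_def by (rule weight_moments(4)[OF p net deg[OF i]])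
    also have "\<dots> \<le> B"
      unfolding B_def using max_deg_ge[OF i, of E] by (intro divide_right_mono power_mono) auto
    finally show ?thesis .
  qed
  have uncorr: "\<mu> (\<lambda>z. X i z * X j z) = \<mu> (X i) * \<mu> (X j)" if "i < n" "j < n" "\<not> R i j" for i j
  proof -
    have dep: "depends_only_on (closed_neighborhood E k) (X k)" for k
    proof (rule depends_only_onI)
      fix z z' :: "nat \<Rightarrow> bool" assume "\<And>l. l \<in> closed_neighborhood E k \<Longrightarrow> z l = z' l"
      then have "z k = z' k" "exposure E k z = exposure E k z'" "weight D E k z = weight D E k z'"
        by (auto simp: closed_neighborhood_def intro!: exposure_cong weight_cong)
      then show "X k z = X k z'" by (simp add: X_def)
    qed
    show ?thesis
      unfolding \<mu>_def D_def using that neighbors_subset[OF net]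
      by (intro expectation_bernoulli_design_mult[OF _ _ _ dep dep])
         (auto simp: R_def closed_neighborhood_def)
  qed
  have "\<mu> (\<lambda>z. ((\<Sum>i<n. X i z) - \<mu> (\<lambda>z. \<Sum>i<n. X i z))\<^sup>2) \<le>
      real (card {..<n}) * (real (max_deg n E) + 1)\<^sup>2 * B"
    unfolding \<mu>_def
  proof (rule variance_sum_le[where R = R])
    show "finite (set_pmf D)" unfolding D_def by (rule finite_set_bernoulli_design)
    show "0 \<le> B" by (simp add: B_def)
    show "real (card {j \<in> {..<n}. R i j}) \<le> (real (max_deg n E) + 1)\<^sup>2" if "i \<in> {..<n}" for i
    proof -
      have "card {j \<in> {..<n}. R i j} \<le> (max_deg n E + 1)\<^sup>2"
        unfolding R_def using that by (intro card_overlapping_neighborhoods[OF net]) simp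
      then have "real (card {j \<in> {..<n}. R i j}) \<le> real ((max_deg n E + 1)\<^sup>2)"
        by (rule of_nat_mono)
      then show ?thesis by (simp add: add.commute)
    qed
  qed (use sq uncorr in \<open>auto simp: \<mu>_def\<close>)
  also have "\<dots> \<le> real n * (2 * real (max_deg n E))\<^sup>2 * B"
  proof -
    \<comment> \<open>The source of the constant 4 in the variance bound.\<close>
    have "(real (max_deg n E) + 1)\<^sup>2 \<le> (2 * real (max_deg n E))\<^sup>2"
      using d by (intro power_mono) auto
    then show ?thesis
      unfolding card_lessThan by (intro mult_right_mono mult_left_mono) (simp_all add: B_def)
  qed
  also have "\<dots> = 4 / (p * (1 - p))\<^sup>2 * real n * real (max_deg n E) ^ 4"
    by (simp add: B_def power_mult_distrib)
  \<comment> \<open>The fourth power of the maximum degree is weakened to the fifth so that the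
    final bound is a multiple of \<open>\<tau> ^ 4\<close>.\<close>
  also have "\<dots> \<le> 4 / (p * (1 - p))\<^sup>2 * real n * real (max_deg n E) ^ 5"
    using d by (intro mult_left_mono power_increasing) auto
  finally have var: "\<mu> (\<lambda>z. ((\<Sum>i<n. X i z) - \<mu> (\<lambda>z. \<Sum>i<n. X i z))\<^sup>2)
      \<le> 4 / (p * (1 - p))\<^sup>2 * real n * real (max_deg n E) ^ 5" .
  have "\<mu> (\<lambda>z. (G z - \<mu> G)\<^sup>2) = \<mu> (\<lambda>z. ((\<Sum>i<n. X i z) - \<mu> (\<lambda>z. \<Sum>i<n. X i z))\<^sup>2 / (real n)\<^sup>2)"
  proof (rule \<mu>_cong)
    fix z assume "z \<in> interventions n"
    moreover have "\<mu> G = \<mu> (\<lambda>z. \<Sum>i<n. X i z) / real n"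
      unfolding mean by (simp add: \<mu>_def D_def)
    ultimately show "(G z - \<mu> G)\<^sup>2 = ((\<Sum>i<n. X i z) - \<mu> (\<lambda>z. \<Sum>i<n. X i z))\<^sup>2 / (real n)\<^sup>2"
      by (simp add: G diff_divide_distrib[symmetric] power_divide)
  qed
  also have "\<dots> = \<mu> (\<lambda>z. ((\<Sum>i<n. X i z) - \<mu> (\<lambda>z. \<Sum>i<n. X i z))\<^sup>2) / (real n)\<^sup>2"
    by (simp add: \<mu>_def)
  also have "\<dots> \<le> 4 / (p * (1 - p))\<^sup>2 * real n * real (max_deg n E) ^ 5 / (real n)\<^sup>2"
    using var by (rule divide_right_mono) simp
  also have "\<dots> = 4 / (p * (1 - p))\<^sup>2 * (real (max_deg n E) ^ 5 / real n)"
    using n by (simp add: power2_eq_square)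
  finally show "measure_pmf.variance D G \<le> 4 / (p * (1 - p))\<^sup>2 * (real (max_deg n E) ^ 5 / real n)"
    by (simp add: \<mu>_def)
qed

section \<open>Error probabilities of the threshold test\<close>

text \<open>Stated for any event that forces a deviation of at least \<open>a\<close>, so that it
  serves false rejections and missed detections alike.\<close>

lemma expectation_Chebyshev:
  fixes G :: "'a \<Rightarrow> real"
  assumes fin: "finite (set_pmf D)" and a: "a > 0"
    and Q: "\<And>z. Q z \<Longrightarrow> a \<le> \<bar>G z - measure_pmf.expectation D G\<bar>"
  shows "measure_pmf.expectation D (\<lambda>z. of_bool (Q z)) \<le> measure_pmf.variance D G / a\<^sup>2"
proof -
  have "measure_pmf.expectation D (\<lambda>z. of_bool (Q z))
      \<le> measure_pmf.expectation D (\<lambda>z. (G z - measure_pmf.expectation D G)\<^sup>2 / a\<^sup>2)"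
  proof (rule integral_mono)
    fix z
    show "(of_bool (Q z) :: real) \<le> (G z - measure_pmf.expectation D G)\<^sup>2 / a\<^sup>2"
    proof (cases "Q z")
      case True
      then have "a\<^sup>2 \<le> \<bar>G z - measure_pmf.expectation D G\<bar>\<^sup>2"
        using a Q by (intro power_mono) auto
      then show ?thesis using a True by simp
    qed simp
  qed (simp_all add: integrable_measure_pmf_finite[OF fin])
  then show ?thesis by simp
qed

lemma null_model_subset: "null_model n \<subseteq> linear_in_means_model n E"
proof
  fix y assume "y \<in> null_model n"
  then obtain \<alpha>1 \<alpha>0 where y: "y \<in> outcome_funs n" "outcome_norm n y \<le> 1"
      "\<forall>i<n. \<forall>z\<in>interventions n. y z i = \<alpha>1 i * of_bool (z i) + \<alpha>0 i * of_bool (\<not> z i)"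
    unfolding null_model_def by blast
  have "\<forall>i<n. \<forall>z\<in>interventions n. y z i = \<alpha>0 i + (\<alpha>1 i - \<alpha>0 i) * of_bool (z i) + 0 * exposure E i z"
    using y(3) by (simp add: of_bool_def)
  then have "\<exists>\<beta>1 \<beta>2 \<beta>3. \<forall>i<n. \<forall>z\<in>interventions n.
      y z i = \<beta>1 i + \<beta>2 i * of_bool (z i) + \<beta>3 i * exposure E i z"
    by (intro exI[of _ \<alpha>0] exI[of _ "\<lambda>i. \<alpha>1 i - \<alpha>0 i"] exI[of _ "\<lambda>_. 0"])
  then show "y \<in> linear_in_means_model n E"
    using y by (simp add: linear_in_means_model_def)
qed

text \<open>The coefficient is a definite description, so reading off 0 from the null form rests on
  its uniqueness, which needs a neighbor.\<close>

lemma separation_null_model: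
  assumes net: "network n E" and deg: "\<And>i. i < n \<Longrightarrow> deg E i > 0" and y: "y \<in> null_model n"
  shows "separation n E y = 0"
proof -
  obtain \<alpha>1 \<alpha>0 where
      y: "\<forall>i<n. \<forall>z\<in>interventions n. y z i = \<alpha>1 i * of_bool (z i) + \<alpha>0 i * of_bool (\<not> z i)"
    using y unfolding null_model_def by blast
  have "interference_coeff n E y i = 0" if "i < n" for i
    using net that deg[OF that] y
    by (intro interference_coeff_eq[where a = "\<alpha>0 i" and c = "\<alpha>1 i - \<alpha>0 i"])
       (auto simp: deg_def of_bool_def)
  then show ?thesis by (simp add: separation_def)
qed

lemma sup0_le: "0 \<le> c \<Longrightarrow> (\<And>x. x \<in> A \<Longrightarrow> f x \<le> c) \<Longrightarrow> sup0 f A \<le> c"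
  by (auto simp: sup0_def intro: cSUP_least)

text \<open>The upper bound \<open>c\<close> guarantees that the real supremum dominates the
  values.\<close>

lemma sup0_nonneg:
  assumes "\<And>x. x \<in> A \<Longrightarrow> 0 \<le> f x" "\<And>x. x \<in> A \<Longrightarrow> f x \<le> c"
  shows "0 \<le> sup0 f A"
proof (cases "A = {}")
  case False
  then obtain x where x: "x \<in> A" by blast
  have "bdd_above (f ` A)" using assms(2) by (auto simp: bdd_above_def)
  then have "f x \<le> (SUP x\<in>A. f x)" using x by (intro cSUP_upper)
  then show ?thesis using assms(1)[OF x] False by (simp add: sup0_def)
qed (simp add: sup0_def)

lemma testing_error_nonneg: "0 \<le> testing_error n E (bernoulli_design m p) \<phi> \<delta>"
proof -
  let ?D = "bernoulli_design m p"
  have *: "measure_pmf.expectation ?D (\<lambda>z. of_bool (Q z)) \<le> (1 :: real)" for Q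
    using integral_mono[of ?D "\<lambda>z. of_bool (Q z)" "\<lambda>_. 1 :: real"] by simp
  show ?thesis
    unfolding testing_error_def
    by (intro add_nonneg_nonneg sup0_nonneg[where c = 1] integral_nonneg_AE)
       (use * in \<open>auto simp: of_bool_not_iff[symmetric] simp del: of_bool_not_iff\<close>)
qed

text \<open>Under the null the estimator has mean 0, and a rejection is a deviation by \<tau>. Under
  the alternative the mean is at least \<delta> while \<tau> is at most half of it, so a miss is a
  deviation by \<open>\<delta> / 2\<close>. Chebyshev's inequality with variance at most
  \<open>K * \<tau> ^ 4\<close> bounds both.\<close>

lemma testing_error_le:
  fixes n :: nat and p \<delta> :: real
  assumes p: "0 < p" "p < 1" and n: "n > 0" and net: "network n E"
    and deg: "\<And>i. i < n \<Longrightarrow> deg E i \<ge> 2"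
    and \<delta>: "\<delta> > 0" and \<tau>: "threshold n E \<le> \<delta> / 2"
  defines "D \<equiv> bernoulli_design n p" and "K \<equiv> 4 / (p * (1 - p))\<^sup>2"
  shows "testing_error n E D (threshold_test n D E) \<delta>
    \<le> K * (threshold n E)\<^sup>2 + K * threshold n E ^ 4 / (\<delta> / 2)\<^sup>2"
proof -
  define \<tau> where "\<tau> = threshold n E"
  define r where "r = real (max_deg n E) ^ 5 / real n"
  have "max_deg n E \<ge> 2" using deg[OF n] max_deg_ge[OF n, of E] by simp
  then have r: "r > 0" using n by (simp add: r_def)
  then have \<tau>0: "\<tau> > 0" unfolding \<tau>_def threshold_def r_def[symmetric] by simp
  have "\<tau> ^ 4 = r powr (1 / 4 * real 4)"
    unfolding \<tau>_def threshold_def r_def[symmetric] using r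
    by (simp only: powr_powr[symmetric]) (simp add: powr_realpow)
  then have \<tau>4: "\<tau> ^ 4 = r" using r by simp
  have K: "K > 0" using p by (simp add: K_def)
  have mean: "measure_pmf.expectation D (\<lambda>z. g_hat n D E z (y z)) = separation n E y"
    and var: "measure_pmf.variance D (\<lambda>z. g_hat n D E z (y z)) \<le> K * \<tau> ^ 4"
    if "y \<in> linear_in_means_model n E" for y
    using g_hat_mean_variance[OF p n net deg that] unfolding \<tau>4 K_def D_def r_def by auto
  have "measure_pmf.expectation D (\<lambda>z. of_bool (threshold_test n D E z (y z))) \<le> K * \<tau>\<^sup>2"
    if y: "y \<in> null_model n" for y
  proof -
    have lim: "y \<in> linear_in_means_model n E" using y null_model_subset by blast
    have "separation n E y = 0"
      using separation_null_model[OF net _ y] deg by (metis gr0I not_numeral_le_zero)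
    then have "measure_pmf.expectation D (\<lambda>z. of_bool (threshold_test n D E z (y z)))
        \<le> measure_pmf.variance D (\<lambda>z. g_hat n D E z (y z)) / \<tau>\<^sup>2"
      using mean[OF lim] \<tau>0 unfolding D_def
      by (intro expectation_Chebyshev finite_set_bernoulli_design) (auto simp: threshold_test_def \<tau>_def)
    also have "\<dots> \<le> K * \<tau> ^ 4 / \<tau>\<^sup>2" using var[OF lim] by (intro divide_right_mono) auto
    also have "\<dots> = K * \<tau>\<^sup>2" using \<tau>0 by (simp add: power2_eq_square power4_eq_xxxx)
    finally show ?thesis .
  qed
  then have I: "sup0 (\<lambda>y. measure_pmf.expectation D (\<lambda>z. of_bool (threshold_test n D E z (y z)))) (null_model n)
      \<le> K * \<tau>\<^sup>2"
    using K by (intro sup0_le) auto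
  have "measure_pmf.expectation D (\<lambda>z. 1 - of_bool (threshold_test n D E z (y z))) \<le> K * \<tau> ^ 4 / (\<delta> / 2)\<^sup>2"
    if y: "y \<in> separated_model n E \<delta>" for y
  proof -
    have lim: "y \<in> linear_in_means_model n E" and sep: "\<delta> \<le> separation n E y"
      using y by (auto simp: separated_model_def)
    have "measure_pmf.expectation D (\<lambda>z. of_bool (\<not> threshold_test n D E z (y z)))
        \<le> measure_pmf.variance D (\<lambda>z. g_hat n D E z (y z)) / (\<delta> / 2)\<^sup>2"
      unfolding D_def
    proof (rule expectation_Chebyshev[OF finite_set_bernoulli_design])
      fix z assume "\<not> threshold_test n (bernoulli_design n p) E z (y z)"
      then show "\<delta> / 2 \<le> \<bar>g_hat n (bernoulli_design n p) E z (y z) -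
          measure_pmf.expectation (bernoulli_design n p) (\<lambda>z. g_hat n (bernoulli_design n p) E z (y z))\<bar>"
        using mean[OF lim] sep \<tau> unfolding threshold_test_def D_def by linarith
    qed (use \<delta> in simp)
    also have "\<dots> \<le> K * \<tau> ^ 4 / (\<delta> / 2)\<^sup>2" using var[OF lim] by (intro divide_right_mono) auto
    finally show ?thesis by (simp add: of_bool_not_iff)
  qed
  then have II: "sup0 (\<lambda>y. measure_pmf.expectation D (\<lambda>z. 1 - of_bool (threshold_test n D E z (y z))))
      (separated_model n E \<delta>) \<le> K * \<tau> ^ 4 / (\<delta> / 2)\<^sup>2"
    using K by (intro sup0_le) auto
  show ?thesis
    using add_mono[OF I II] by (simp add: testing_error_def \<tau>_def)
qed

section \<open>Passage to the limit\<close>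

lemma threshold_tendsto_0:
  assumes "(\<lambda>n. real (max_deg n (E n))) \<in> o(\<lambda>n. real n powr (1 / 5))"
  shows "(\<lambda>n. threshold n (E n)) \<longlonglongrightarrow> 0"
proof -
  have "(\<lambda>n. real (max_deg n (E n)) / real n powr (1 / 5)) \<longlonglongrightarrow> 0"
    using assms by (rule smalloD_tendsto)
  then have "(\<lambda>n. ((real (max_deg n (E n)) / real n powr (1 / 5)) ^ 5) powr (1 / 4)) \<longlonglongrightarrow> (0 ^ 5) powr (1 / 4)"
    \<comment> \<open>The base tends to 0, so this version of the rule is needed: it asks for a
      positive exponent and an eventually nonnegative base.\<close>
    by (intro tendsto_powr' tendsto_power) auto
  moreover have "((real (max_deg n (E n)) / real n powr (1 / 5)) ^ 5) powr (1 / 4) = threshold n (E n)" for n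
    \<comment> \<open>At \<open>n = 0\<close> the maximum is over an empty set, but division by zero
      makes both sides 0.\<close>
    by (cases "n = 0") (simp_all add: threshold_def power_divide powr_power)
  ultimately show ?thesis by simp
qed

theorem theorem4p2:
  fixes E :: "nat \<Rightarrow> (nat \<times> nat) set" and p :: real
  assumes p: "0 < p" "p < 1"
    and network: "\<And>n. n \<ge> 3 \<Longrightarrow> network n (E n)"
    and min_deg: "\<And>n i. n \<ge> 3 \<Longrightarrow> i < n \<Longrightarrow> deg (E n) i \<ge> 2"
    and max_deg: "(\<lambda>n. real (max_deg n (E n))) \<in> o(\<lambda>n. real n powr (1 / 5))"
  shows "\<forall>\<delta>>0. (\<lambda>n. testing_error n (E n) (bernoulli_design n p)
                  (threshold_test n (bernoulli_design n p) (E n)) \<delta>) \<longlonglongrightarrow> 0"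
proof (intro allI impI)
  fix \<delta> :: real assume \<delta>: "\<delta> > 0"
  define K where "K = 4 / (p * (1 - p))\<^sup>2"
  let ?R = "\<lambda>n. testing_error n (E n) (bernoulli_design n p)
                  (threshold_test n (bernoulli_design n p) (E n)) \<delta>"
  let ?\<tau> = "\<lambda>n. threshold n (E n)"
  have \<tau>: "?\<tau> \<longlonglongrightarrow> 0" using max_deg by (rule threshold_tendsto_0)
  then have "\<forall>\<^sub>F n in sequentially. ?\<tau> n < \<delta> / 2"
    using \<delta> by (intro order_tendstoD) auto
  \<comment> \<open>The network is constrained only from 3 units on, the least positive number that
    allows degrees of at least 2 without self-loops.\<close>
  moreover have "\<forall>\<^sub>F n in sequentially. n \<ge> 3" by (rule eventually_ge_at_top)
  ultimately have upper: "\<forall>\<^sub>F n in sequentially. ?R n \<le> K * (?\<tau> n)\<^sup>2 + K * ?\<tau> n ^ 4 / (\<delta> / 2)\<^sup>2"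
  proof eventually_elim
    case (elim n)
    then show ?case
      unfolding K_def by (intro testing_error_le[OF p _ network min_deg \<delta>]) auto
  qed
  have "(\<lambda>n. K * (?\<tau> n)\<^sup>2 + K * ?\<tau> n ^ 4 / (\<delta> / 2)\<^sup>2) \<longlonglongrightarrow> K * 0\<^sup>2 + K * 0 ^ 4 / (\<delta> / 2)\<^sup>2"
    using \<delta> by (intro tendsto_intros \<tau>) auto
  then have "(\<lambda>n. K * (?\<tau> n)\<^sup>2 + K * ?\<tau> n ^ 4 / (\<delta> / 2)\<^sup>2) \<longlonglongrightarrow> 0" by simp
  then show "?R \<longlonglongrightarrow> 0"
    by (rule tendsto_sandwich[OF always_eventually upper tendsto_const, rotated])
       (simp add: testing_error_nonneg)
qed

end
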